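(* Let $X$ and $Y$ be graphs and let $X\circ Y$ be their lexicographic product. Suppose that every automorphism of $X\circ Y$ is natural. Then $D(X\circ Y)=k$, where $k$ is the least integer such that $\Phi_k(Y)\geq D(X)$.
   Context: All graphs are finite, simple and undirected (with nonempty vertex set). A vertex coloring of a graph $G$ (not necessarily proper) is distinguishing if the only automorphism of $G$ preserving the color of every vertex is the identity. The distinguishing number $D(G)$ is the least number of colors in a distinguishing coloring of $G$. Two colorings $c_1,c_2$ of $G$ are equivalent if there is an automorphism $\alpha$ of $G$ with $c_1(v)=c_2(\alpha(v))$ for all $v\in V(G)$. For a positive integer $k$, $\Phi_k(G)$ is the number of non-equivalent distinguishing colorings (i.e. equivalence classes of distinguishing colorings) $c:V(G)\to\{1,\dots,k\}$, where not all $k$ colors need be used. The lexicographic product $X\circ Y$ has vertex set $\{(x,y): x\in V(X),\, y\in V(Y)\}$, and $(x,y)$ is adjacent to $(x',y')$ if and only if either $xx'\in E(X)$, or $x=x'$ and $yy'\in E(Y)$. For $x\in V(X)$ write $Y_x=\{x\}\times V(Y)$ for the copy of $Y$ at $x$. An automorphism $\mu$ of $X\circ Y$ is natural if for every $x_1\in V(X)$ there is $x_2\in V(X)$ with $\mu(Y_{x_1})=Y_{x_2}$. *)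

theory Defs
  imports "Graph_Theory.Pair_Digraph" "HOL-Library.FuncSet"
begin

text \<open>
  A finite simple undirected graph is a \<^locale>\<open>pair_graph\<close>: finite vertex set, symmetric
  irreflexive edge relation. Each edge is stored as both ordered pairs. The locale admits the
  empty graph, so nonemptiness is a separate hypothesis wherever it is needed.
\<close>

text \<open>
  Automorphisms and colorings are total functions, of which only the values on the vertex set
  matter; in particular ``being the identity'' means fixing every vertex.
\<close>

definition automorphism :: "'a pair_pre_digraph \<Rightarrow> ('a \<Rightarrow> 'a) \<Rightarrow> bool" where
  "automorphism G \<alpha> \<longleftrightarrow>
     bij_betw \<alpha> (pverts G) (pverts G) \<and>
     (\<forall>u\<in>pverts G. \<forall>v\<in>pverts G. (u, v) \<in> parcs G \<longleftrightarrow> (\<alpha> u, \<alpha> v) \<in> parcs G)"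

definition distinguishing :: "'a pair_pre_digraph \<Rightarrow> ('a \<Rightarrow> 'c) \<Rightarrow> bool" where
  "distinguishing G c \<longleftrightarrow>
     (\<forall>\<alpha>. automorphism G \<alpha> \<and> (\<forall>v\<in>pverts G. c (\<alpha> v) = c v) \<longrightarrow> (\<forall>v\<in>pverts G. \<alpha> v = v))"

text \<open>
  Extensional functions are used so that each coloring of the vertex set is represented exactly
  once.
\<close>

definition dist_colorings :: "nat \<Rightarrow> 'a pair_pre_digraph \<Rightarrow> ('a \<Rightarrow> nat) set" where
  "dist_colorings k G = {c \<in> pverts G \<rightarrow>\<^sub>E {1..k}. distinguishing G c}"

definition distinguishing_number :: "'a pair_pre_digraph \<Rightarrow> nat" where
  "distinguishing_number G = (LEAST k. dist_colorings k G \<noteq> {})"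

definition equivalent_colorings ::
    "'a pair_pre_digraph \<Rightarrow> ('a \<Rightarrow> 'c) \<Rightarrow> ('a \<Rightarrow> 'c) \<Rightarrow> bool" where
  "equivalent_colorings G c1 c2 \<longleftrightarrow>
     (\<exists>\<alpha>. automorphism G \<alpha> \<and> (\<forall>v\<in>pverts G. c1 v = c2 (\<alpha> v)))"

definition num_dist_colorings :: "nat \<Rightarrow> 'a pair_pre_digraph \<Rightarrow> nat" where
  "num_dist_colorings k G =
     card (dist_colorings k G //
       {(c1, c2) \<in> dist_colorings k G \<times> dist_colorings k G. equivalent_colorings G c1 c2})"

definition lex_product ::
    "'a pair_pre_digraph \<Rightarrow> 'b pair_pre_digraph \<Rightarrow> ('a \<times> 'b) pair_pre_digraph" where
  "lex_product X Y =
     \<lparr> pverts = pverts X \<times> pverts Y,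
       parcs = {((x, y), (x', y')) | x y x' y'.
         x \<in> pverts X \<and> y \<in> pverts Y \<and> x' \<in> pverts X \<and> y' \<in> pverts Y \<and>
         ((x, x') \<in> parcs X \<or> x = x' \<and> (y, y') \<in> parcs Y)} \<rparr>"

definition natural_automorphism ::
    "'a pair_pre_digraph \<Rightarrow> 'b pair_pre_digraph \<Rightarrow> ('a \<times> 'b \<Rightarrow> 'a \<times> 'b) \<Rightarrow> bool" where
  "natural_automorphism X Y \<mu> \<longleftrightarrow>
     automorphism (lex_product X Y) \<mu> \<and>
     (\<forall>x1\<in>pverts X. \<exists>x2\<in>pverts X. \<mu> ` ({x1} \<times> pverts Y) = {x2} \<times> pverts Y)"

text \<open>The following facts show that the definitions above are not degenerate.\<close>

lemma pair_graph_lex_product: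
  assumes "pair_graph X" "pair_graph Y"
  shows "pair_graph (lex_product X Y)"
proof -
  interpret X: pair_graph X by fact
  interpret Y: pair_graph Y by fact
  have sub: "parcs (lex_product X Y) \<subseteq>
      (pverts X \<times> pverts Y) \<times> (pverts X \<times> pverts Y)"
    by (auto simp: lex_product_def)
  have "finite (parcs (lex_product X Y))"
    using finite_subset[OF sub] X.pair_finite_verts Y.pair_finite_verts by blast
  moreover have "symmetric (with_proj (lex_product X Y))"
    using X.sym_arcs Y.sym_arcs unfolding symmetric_def
    by (auto simp: lex_product_def sym_def)
  ultimately show ?thesis
    using X.pair_finite_verts Y.pair_finite_verts X.pair_no_loops Y.pair_no_loops
    by unfold_locales (auto simp: lex_product_def)
qed

lemma finite_dist_colorings:
  assumes "pair_graph G"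
  shows "finite (dist_colorings k G)"
proof -
  interpret pair_graph G by fact
  have "finite (pverts G \<rightarrow>\<^sub>E {1..k})"
    using pair_finite_verts by (intro finite_PiE) auto
  then show ?thesis
    unfolding dist_colorings_def by (rule finite_subset[rotated]) blast
qed

lemma dist_colorings_nonempty:
  assumes "pair_graph G"
  shows "dist_colorings (card (pverts G)) G \<noteq> {}"
proof -
  interpret pair_graph G by fact
  obtain f where f: "bij_betw f (pverts G) {1..card (pverts G)}"
    using ex_bij_betw_finite_nat[of "pverts G"] pair_finite_verts
    by (metis card_atLeastAtMost diff_Suc_1 finite_atLeastAtMost finite_same_card_bij)
  have "restrict f (pverts G) \<in> dist_colorings (card (pverts G)) G"
    using f unfolding dist_colorings_def distinguishing_def automorphism_def bij_betw_def
    by (auto simp: inj_on_def) (metis imageI)+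
  then show ?thesis by blast
qed

lemma equiv_equivalent_colorings:
  "equiv (dist_colorings k G)
     {(c1, c2) \<in> dist_colorings k G \<times> dist_colorings k G. equivalent_colorings G c1 c2}"
proof (rule equivI)
  let ?R = "{(c1, c2) \<in> dist_colorings k G \<times> dist_colorings k G. equivalent_colorings G c1 c2}"
  show "?R \<subseteq> dist_colorings k G \<times> dist_colorings k G" by auto
  have "equivalent_colorings G c c" for c :: "'a \<Rightarrow> nat"
    unfolding equivalent_colorings_def automorphism_def
    by (rule exI[of _ id]) (auto simp: bij_betw_def)
  then show "refl_on (dist_colorings k G) ?R" by (auto simp: refl_on_def)
  have "equivalent_colorings G c2 c1" if "equivalent_colorings G c1 c2" for c1 c2 :: "'a \<Rightarrow> nat"
  proof -
    obtain \<alpha> where a: "automorphism G \<alpha>" "\<forall>v\<in>pverts G. c1 v = c2 (\<alpha> v)"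
      using \<open>equivalent_colorings G c1 c2\<close> unfolding equivalent_colorings_def by blast
    define \<beta> where "\<beta> = inv_into (pverts G) \<alpha>"
    have bij: "bij_betw \<alpha> (pverts G) (pverts G)" using a by (simp add: automorphism_def)
    have b: "bij_betw \<beta> (pverts G) (pverts G)"
      unfolding \<beta>_def using bij by (rule bij_betw_inv_into)
    have ab: "\<alpha> (\<beta> v) = v" "\<beta> v \<in> pverts G" if "v \<in> pverts G" for v
      using that bij_betw_inv_into_right[OF bij] bij_betwE[OF b] by (auto simp: \<beta>_def)
    have "automorphism G \<beta>"
      using a(1) b ab unfolding automorphism_def by metis
    moreover have "\<forall>v\<in>pverts G. c2 v = c1 (\<beta> v)" using a(2) ab by metis
    ultimately show ?thesis unfolding equivalent_colorings_def by blast
  qed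
  then show "sym ?R" by (auto simp: sym_def)
  have "equivalent_colorings G c1 c3"
    if e: "equivalent_colorings G c1 c2" "equivalent_colorings G c2 c3"
    for c1 c2 c3 :: "'a \<Rightarrow> nat"
  proof -
    obtain \<alpha> where a: "automorphism G \<alpha>" "\<forall>v\<in>pverts G. c1 v = c2 (\<alpha> v)"
      using e(1) unfolding equivalent_colorings_def by blast
    obtain \<beta> where b: "automorphism G \<beta>" "\<forall>v\<in>pverts G. c2 v = c3 (\<beta> v)"
      using e(2) unfolding equivalent_colorings_def by blast
    have m: "\<alpha> v \<in> pverts G" if "v \<in> pverts G" for v
      using a(1) that unfolding automorphism_def by (auto dest: bij_betwE)
    have "automorphism G (\<beta> \<circ> \<alpha>)"
      using a(1) b(1) m unfolding automorphism_def by (auto intro: bij_betw_trans)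
    moreover have "\<forall>v\<in>pverts G. c1 v = c3 ((\<beta> \<circ> \<alpha>) v)" using a(2) b(2) m by simp
    ultimately show ?thesis unfolding equivalent_colorings_def by blast
  qed
  then show "trans ?R" unfolding trans_def by blast
qed

end

theory Submission
  imports Defs
begin

text \<open>
  For nonempty \<open>Y\<close>, an automorphism of \<open>X \<circ> Y\<close> that permutes the fibres \<open>Y\<^sub>x\<close> is the same
  thing as an automorphism \<open>\<sigma>\<close> of \<open>X\<close> together with one automorphism \<open>\<phi> x\<close> of \<open>Y\<close> for every vertex \<open>x\<close>, acting by
  \<open>(x, y) \<mapsto> (\<sigma> x, \<phi> x y)\<close>; these maps form the wreath product of the two automorphism groups. A
  coloring \<open>c\<close> of \<open>X \<circ> Y\<close> is a family of colorings \<open>c (x, \<cdot>)\<close> of \<open>Y\<close>, and such a map preserves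
  \<open>c\<close> exactly if every \<open>\<phi> x\<close> carries the coloring over \<open>x\<close> to the one over \<open>\<sigma> x\<close>.

  Hence, if the product has no other automorphisms, \<open>c\<close> is distinguishing if and only if each
  \<open>c (x, \<cdot>)\<close> is a distinguishing coloring of \<open>Y\<close> and the coloring of \<open>X\<close> that
  gives \<open>x\<close> the equivalence class of \<open>c (x, \<cdot>)\<close> is distinguishing:
  a fibre can be carried onto another without changing colors only if the two colorings are
  equivalent. With \<open>k\<close> colors there are \<open>\<Phi>\<^sub>k(Y)\<close> such classes, so they serve as a palette for a
  distinguishing coloring of \<open>X\<close> precisely if \<open>\<Phi>\<^sub>k(Y) \<ge> D(X)\<close>. The two implications are
  \<open>num_dist_colorings_ge_if_lex_product\<close>, which builds automorphisms of the product from their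
  components, and \<open>lex_product_colorable_if_num_dist_colorings_ge\<close>, which takes a given one apart
  by naturality. So both sides of the claimed equation are the minimum of the same set of \<open>k\<close>.
\<close>

section \<open>Automorphisms of a lexicographic product\<close>

lemma automorphism_in_verts:
  "automorphism G \<alpha> \<Longrightarrow> v \<in> pverts G \<Longrightarrow> \<alpha> v \<in> pverts G"
  by (auto simp: automorphism_def dest: bij_betwE)

lemma automorphism_id: "automorphism G (\<lambda>v. v)"
  by (auto simp: automorphism_def bij_betw_def)

lemma pverts_lex_product [simp]: "pverts (lex_product X Y) = pverts X \<times> pverts Y"
  by (simp add: lex_product_def)

lemma arc_lex_product_iff:
  assumes "x \<in> pverts X" "x' \<in> pverts X" "y \<in> pverts Y" "y' \<in> pverts Y"
  shows "((x, y), (x', y')) \<in> parcs (lex_product X Y) \<longleftrightarrow>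
    (x, x') \<in> parcs X \<or> x = x' \<and> (y, y') \<in> parcs Y"
  using assms by (auto simp: lex_product_def)

lemma automorphism_lex_productI:
  assumes \<sigma>: "automorphism X \<sigma>"
    and \<phi>: "\<And>x. x \<in> pverts X \<Longrightarrow> automorphism Y (\<phi> x)"
  shows "automorphism (lex_product X Y) (\<lambda>(x, y). (\<sigma> x, \<phi> x y))"
proof -
  let ?\<mu> = "\<lambda>(x, y). (\<sigma> x, \<phi> x y)"
  have bij\<sigma>: "bij_betw \<sigma> (pverts X) (pverts X)"
    using \<sigma> by (simp add: automorphism_def)
  have bij\<phi>: "bij_betw (\<phi> x) (pverts Y) (pverts Y)" if "x \<in> pverts X" for x
    using \<phi>[OF that] by (simp add: automorphism_def)
  have eq\<sigma>: "\<sigma> x = \<sigma> x' \<longleftrightarrow> x = x'" if "x \<in> pverts X" "x' \<in> pverts X" for x x'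
    using that bij\<sigma> by (auto simp: bij_betw_def dest: inj_onD)
  have "inj_on ?\<mu> (pverts X \<times> pverts Y)"
    using eq\<sigma> bij\<phi> by (fastforce simp: inj_on_def bij_betw_def)
  moreover have "?\<mu> ` (pverts X \<times> pverts Y) = pverts X \<times> pverts Y"
  proof (intro equalityI subsetI)
    fix p assume "p \<in> ?\<mu> ` (pverts X \<times> pverts Y)"
    then show "p \<in> pverts X \<times> pverts Y"
      by (auto intro: automorphism_in_verts[OF \<sigma>] automorphism_in_verts[OF \<phi>])
  next
    fix p assume "p \<in> pverts X \<times> pverts Y"
    then obtain a b where p: "p = (a, b)" "a \<in> pverts X" "b \<in> pverts Y" by auto
    obtain x where x: "x \<in> pverts X" "a = \<sigma> x"
      using p(2) bij\<sigma> by (auto simp: bij_betw_def)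
    obtain y where y: "y \<in> pverts Y" "b = \<phi> x y"
      using p(3) bij\<phi>[OF x(1)] by (auto simp: bij_betw_def)
    show "p \<in> ?\<mu> ` (pverts X \<times> pverts Y)"
      using p x y by force
  qed
  ultimately have "bij_betw ?\<mu> (pverts X \<times> pverts Y) (pverts X \<times> pverts Y)"
    by (simp add: bij_betw_def)
  moreover have "((x, y), (x', y')) \<in> parcs (lex_product X Y) \<longleftrightarrow>
      (?\<mu> (x, y), ?\<mu> (x', y')) \<in> parcs (lex_product X Y)"
    if "x \<in> pverts X" "x' \<in> pverts X" "y \<in> pverts Y" "y' \<in> pverts Y" for x x' y y'
  proof -
    have "(x, x') \<in> parcs X \<longleftrightarrow> (\<sigma> x, \<sigma> x') \<in> parcs X"
      and "(y, y') \<in> parcs Y \<longleftrightarrow> (\<phi> x y, \<phi> x y') \<in> parcs Y"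
      using \<sigma> \<phi>[OF that(1)] that unfolding automorphism_def by blast+
    moreover have "\<sigma> x \<in> pverts X" "\<sigma> x' \<in> pverts X" "\<phi> x y \<in> pverts Y" "\<phi> x' y' \<in> pverts Y"
      using that automorphism_in_verts[OF \<sigma>] automorphism_in_verts[OF \<phi>] by blast+
    ultimately show ?thesis
      using that eq\<sigma>[OF that(1,2)] by (cases "x = x'") (simp_all add: arc_lex_product_iff)
  qed
  ultimately show ?thesis
    by (auto simp: automorphism_def)
qed

text \<open>
  The converse. Loop-freeness of \<open>X\<close> makes the product induce exactly \<open>Y\<close> on every fibre, and
  conversely the adjacency of any two points in different fibres only depends on their first
  coordinates, so that the permutation of the fibres inherits adjacency from \<open>\<mu>\<close>.
\<close>

lemma natural_automorphismE:
  assumes X: "pair_graph X" and Y: "pverts Y \<noteq> {}"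
    and \<mu>: "natural_automorphism X Y \<mu>"
  obtains \<sigma> \<phi> where "automorphism X \<sigma>"
    and "\<And>x. x \<in> pverts X \<Longrightarrow> automorphism Y (\<phi> x)"
    and "\<And>x y. x \<in> pverts X \<Longrightarrow> y \<in> pverts Y \<Longrightarrow> \<mu> (x, y) = (\<sigma> x, \<phi> x y)"
proof -
  interpret X: pair_graph X by fact
  have no_loop: "(x, x) \<notin> parcs X" for x
    using X.pair_no_loops[of "(x, x)"] by auto
  obtain b where b: "b \<in> pverts Y" using Y by blast
  have "\<forall>x\<in>pverts X. \<exists>x'. x' \<in> pverts X \<and> \<mu> ` ({x} \<times> pverts Y) = {x'} \<times> pverts Y"
    using \<mu> by (auto simp: natural_automorphism_def)
  then obtain \<sigma> where \<sigma>: "\<And>x. x \<in> pverts X \<Longrightarrow> \<sigma> x \<in> pverts X"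
      and fib: "\<And>x. x \<in> pverts X \<Longrightarrow> \<mu> ` ({x} \<times> pverts Y) = {\<sigma> x} \<times> pverts Y"
    by (auto simp: bchoice_iff)
  define \<phi> where "\<phi> x y = snd (\<mu> (x, y))" for x y
  have in_fib: "\<mu> (x, y) \<in> {\<sigma> x} \<times> pverts Y" if "x \<in> pverts X" "y \<in> pverts Y" for x y
    using fib[OF that(1)] that(2) by blast
  have \<mu>_eq: "\<mu> (x, y) = (\<sigma> x, \<phi> x y)" and \<phi>: "\<phi> x y \<in> pverts Y"
    if "x \<in> pverts X" "y \<in> pverts Y" for x y
    using in_fib[OF that] by (auto simp: \<phi>_def)
  have arc: "((x, y), (x', y')) \<in> parcs (lex_product X Y) \<longleftrightarrow>
      (\<mu> (x, y), \<mu> (x', y')) \<in> parcs (lex_product X Y)"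
    if "x \<in> pverts X" "x' \<in> pverts X" "y \<in> pverts Y" "y' \<in> pverts Y" for x x' y y'
    using that \<mu> by (auto simp: natural_automorphism_def automorphism_def)
  have inj\<mu>: "inj_on \<mu> (pverts X \<times> pverts Y)"
    using \<mu> by (auto simp: natural_automorphism_def automorphism_def bij_betw_def)
  have eq\<sigma>: "x = x'" if "x \<in> pverts X" "x' \<in> pverts X" "\<sigma> x = \<sigma> x'" for x x'
  proof -
    have "\<mu> (x, b) \<in> \<mu> ` ({x'} \<times> pverts Y)"
      using in_fib[OF that(1) b] fib[OF that(2)] that(3) by simp
    then obtain y where "y \<in> pverts Y" "\<mu> (x, b) = \<mu> (x', y)" by auto
    then show ?thesis
      using inj_onD[OF inj\<mu>, of "(x, b)" "(x', y)"] that b by simp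
  qed
  have "bij_betw \<sigma> (pverts X) (pverts X)"
  proof -
    have "inj_on \<sigma> (pverts X)" using eq\<sigma> by (auto intro: inj_onI)
    moreover have "\<sigma> ` pverts X = pverts X"
      using calculation \<sigma> X.pair_finite_verts by (intro endo_inj_surj) auto
    ultimately show ?thesis by (simp add: bij_betw_def)
  qed
  moreover have "(x, x') \<in> parcs X \<longleftrightarrow> (\<sigma> x, \<sigma> x') \<in> parcs X"
    if "x \<in> pverts X" "x' \<in> pverts X" for x x'
  proof (cases "x = x'")
    case True
    then show ?thesis using no_loop by blast
  next
    case False
    then have "\<sigma> x \<noteq> \<sigma> x'" using eq\<sigma> that by blast
    then show ?thesis
      using arc[OF that b b] False that b
      by (simp add: \<mu>_eq arc_lex_product_iff \<sigma> \<phi>)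
  qed
  ultimately have "automorphism X \<sigma>" by (auto simp: automorphism_def)
  moreover have "automorphism Y (\<phi> x)" if x: "x \<in> pverts X" for x
  proof -
    have "inj_on (\<phi> x) (pverts Y)"
      using inj\<mu> x \<mu>_eq[OF x] by (auto simp: inj_on_def)
    moreover have "\<phi> x ` pverts Y = pverts Y"
    proof -
      have "\<phi> x ` pverts Y = snd ` (\<mu> ` ({x} \<times> pverts Y))"
        by (force simp: \<phi>_def image_iff)
      then show ?thesis using fib[OF x] by simp
    qed
    moreover have "(y, y') \<in> parcs Y \<longleftrightarrow> (\<phi> x y, \<phi> x y') \<in> parcs Y"
      if "y \<in> pverts Y" "y' \<in> pverts Y" for y y'
      using arc[OF x x that] that x no_loop
      by (simp add: \<mu>_eq arc_lex_product_iff \<sigma> \<phi>)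
    ultimately show ?thesis by (simp add: automorphism_def bij_betw_def)
  qed
  ultimately show ?thesis using that \<mu>_eq by blast
qed

section \<open>Equivalence classes of distinguishing colorings as a palette\<close>

lemma dist_colorings_zero: "pverts G \<noteq> {} \<Longrightarrow> dist_colorings 0 G = {}"
  by (auto simp: dist_colorings_def)

text \<open>
  The distinguishing number is defined through the palettes \<open>{1..k}\<close>; any other finite palette
  bounds it just as well.
\<close>

lemma distinguishing_number_le_card:
  assumes c: "distinguishing G c" and C: "finite C" "c ` pverts G \<subseteq> C"
  shows "distinguishing_number G \<le> card C"
proof -
  obtain h where h: "bij_betw h C {1..card C}"
    using finite_same_card_bij[OF C(1), of "{1..card C}"] by auto
  define c' where "c' = restrict (h \<circ> c) (pverts G)"
  have "c v = c w" if "c' v = c' w" "v \<in> pverts G" "w \<in> pverts G" for v w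
    using that C(2) inj_onD[OF bij_betw_imp_inj_on[OF h], of "c v" "c w"] by (auto simp: c'_def)
  then have "distinguishing G c'"
    using c unfolding distinguishing_def by (metis automorphism_in_verts)
  moreover have "c' \<in> pverts G \<rightarrow>\<^sub>E {1..card C}"
    using C(2) bij_betwE[OF h] unfolding c'_def by auto
  ultimately have "dist_colorings (card C) G \<noteq> {}"
    by (auto simp: dist_colorings_def)
  then show ?thesis unfolding distinguishing_number_def by (rule Least_le)
qed

lemma dist_colorings_distinguishing_number:
  assumes "pair_graph G"
  shows "dist_colorings (distinguishing_number G) G \<noteq> {}"
  unfolding distinguishing_number_def
  using dist_colorings_nonempty[OF assms] by (rule LeastI)

definition coloring_equivalence :: "nat \<Rightarrow> 'a pair_pre_digraph \<Rightarrow> (('a \<Rightarrow> nat) \<times> ('a \<Rightarrow> nat)) set"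
  where "coloring_equivalence k G =
    {(c1, c2) \<in> dist_colorings k G \<times> dist_colorings k G. equivalent_colorings G c1 c2}"

lemma equiv_coloring_equivalence: "equiv (dist_colorings k G) (coloring_equivalence k G)"
  unfolding coloring_equivalence_def by (rule equiv_equivalent_colorings)

lemma num_dist_colorings_eq_card:
  "num_dist_colorings k G = card (dist_colorings k G // coloring_equivalence k G)"
  by (simp add: num_dist_colorings_def coloring_equivalence_def)

text \<open>
  A nontrivial symmetry of a single fibre extends by the identity to a nontrivial one of the
  product, so it cannot preserve a distinguishing coloring.
\<close>

lemma dist_colorings_fibre:
  assumes c: "c \<in> dist_colorings k (lex_product X Y)" and x: "x \<in> pverts X"
  shows "(\<lambda>y\<in>pverts Y. c (x, y)) \<in> dist_colorings k Y"
proof -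
  have "distinguishing Y (\<lambda>y\<in>pverts Y. c (x, y))"
    unfolding distinguishing_def
  proof (intro allI impI, elim conjE)
    fix \<alpha> assume \<alpha>: "automorphism Y \<alpha>"
      and pres: "\<forall>v\<in>pverts Y. (\<lambda>y\<in>pverts Y. c (x, y)) (\<alpha> v) = (\<lambda>y\<in>pverts Y. c (x, y)) v"
    define \<phi> where "\<phi> x' = (if x' = x then \<alpha> else (\<lambda>y. y))" for x'
    let ?\<mu> = "\<lambda>(x', y). (x', \<phi> x' y)"
    have "automorphism (lex_product X Y) ?\<mu>"
      by (rule automorphism_lex_productI) (auto simp: \<phi>_def \<alpha> automorphism_id)
    moreover have "\<forall>p\<in>pverts (lex_product X Y). c (?\<mu> p) = c p"
      using pres \<alpha> by (auto simp: \<phi>_def automorphism_in_verts)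
    ultimately have "\<forall>p\<in>pverts (lex_product X Y). ?\<mu> p = p"
      using c unfolding dist_colorings_def distinguishing_def by blast
    then show "\<forall>v\<in>pverts Y. \<alpha> v = v"
      using x by (auto simp: \<phi>_def)
  qed
  then show ?thesis
    using c x by (auto simp: dist_colorings_def PiE_iff)
qed

text \<open>
  Coloring \<open>x\<close> by the class of the coloring on its fibre is distinguishing on \<open>X\<close>: an automorphism
  \<open>\<sigma>\<close> preserving the classes lifts, with one equivalence of colorings chosen over each vertex, to
  an automorphism of the product that preserves \<open>c\<close>.
\<close>

lemma num_dist_colorings_ge_if_lex_product:
  fixes X :: "'a pair_pre_digraph" and Y :: "'b pair_pre_digraph"
  assumes Y: "pair_graph Y" "pverts Y \<noteq> {}"
    and ne: "dist_colorings k (lex_product X Y) \<noteq> {}"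
  shows "distinguishing_number X \<le> num_dist_colorings k Y"
proof -
  obtain c where c: "c \<in> dist_colorings k (lex_product X Y)" using ne by blast
  obtain b where b: "b \<in> pverts Y" using Y by blast
  let ?R = "coloring_equivalence k Y"
  define fib where "fib x = (\<lambda>y\<in>pverts Y. c (x, y))" for x
  have fib: "fib x \<in> dist_colorings k Y" if "x \<in> pverts X" for x
    unfolding fib_def by (rule dist_colorings_fibre[OF c that])
  define f where "f x = ?R `` {fib x}" for x
  have "distinguishing X f"
    unfolding distinguishing_def
  proof (intro allI impI, elim conjE)
    fix \<sigma> assume \<sigma>: "automorphism X \<sigma>" and pres: "\<forall>x\<in>pverts X. f (\<sigma> x) = f x"
    have "\<exists>\<alpha>. automorphism Y \<alpha> \<and> (\<forall>y\<in>pverts Y. fib x y = fib (\<sigma> x) (\<alpha> y))"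
      if x: "x \<in> pverts X" for x
    proof -
      have "(fib x, fib (\<sigma> x)) \<in> ?R"
        using pres x fib automorphism_in_verts[OF \<sigma> x]
        by (intro eq_equiv_class[OF _ equiv_coloring_equivalence]) (auto simp: f_def)
      then show ?thesis by (auto simp: coloring_equivalence_def equivalent_colorings_def)
    qed
    then obtain \<phi> where \<phi>: "\<And>x. x \<in> pverts X \<Longrightarrow> automorphism Y (\<phi> x)"
        and col: "\<And>x y. x \<in> pverts X \<Longrightarrow> y \<in> pverts Y \<Longrightarrow> fib x y = fib (\<sigma> x) (\<phi> x y)"
      by metis
    let ?\<mu> = "\<lambda>(x, y). (\<sigma> x, \<phi> x y)"
    have "automorphism (lex_product X Y) ?\<mu>"
      by (rule automorphism_lex_productI[OF \<sigma> \<phi>])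
    moreover have "\<forall>p\<in>pverts (lex_product X Y). c (?\<mu> p) = c p"
      using col \<phi> by (auto simp: fib_def automorphism_in_verts)
    ultimately have "\<forall>p\<in>pverts (lex_product X Y). ?\<mu> p = p"
      using c unfolding dist_colorings_def distinguishing_def by blast
    then show "\<forall>x\<in>pverts X. \<sigma> x = x" using b by auto
  qed
  moreover have "finite (dist_colorings k Y // ?R)"
    using finite_dist_colorings[OF Y(1)]
    by (rule finite_quotient) (auto simp: coloring_equivalence_def)
  moreover have "f ` pverts X \<subseteq> dist_colorings k Y // ?R"
    using fib by (auto simp: f_def intro: quotientI)
  ultimately show ?thesis
    unfolding num_dist_colorings_eq_card by (rule distinguishing_number_le_card)
qed

text \<open>
  Fill the fibre over \<open>x\<close> with a coloring of \<open>Y\<close> that encodes the color of \<open>x\<close> in an optimal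
  distinguishing coloring of \<open>X\<close>. Inequivalence makes the code readable from the fibre, so an
  automorphism preserving the result fixes every fibre, and then every point of it because the
  colorings on the fibres are distinguishing.
\<close>

lemma lex_product_colorable_if_num_dist_colorings_ge:
  fixes X :: "'a pair_pre_digraph" and Y :: "'b pair_pre_digraph"
  assumes X: "pair_graph X" and Y: "pverts Y \<noteq> {}"
    and nat: "\<And>\<mu>. automorphism (lex_product X Y) \<mu> \<Longrightarrow> natural_automorphism X Y \<mu>"
    and le: "distinguishing_number X \<le> num_dist_colorings k Y"
  shows "dist_colorings k (lex_product X Y) \<noteq> {}"
proof -
  let ?R = "coloring_equivalence k Y" and ?d = "distinguishing_number X"
  obtain f where f: "f \<in> dist_colorings ?d X"
    using dist_colorings_distinguishing_number[OF X] by blast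
  obtain Q where Q: "Q \<subseteq> dist_colorings k Y // ?R" "card Q = ?d" "finite Q"
    using le unfolding num_dist_colorings_eq_card by (rule obtain_subset_with_card_n)
  obtain h where h: "bij_betw h {1..?d} Q"
    using finite_same_card_bij[of "{1..?d}" Q] Q by auto
  \<comment> \<open>There are enough classes to give the colors of \<open>f\<close> pairwise inequivalent colorings of \<open>Y\<close>.\<close>
  define col where "col i = (SOME e. e \<in> h i)" for i
  have hQ: "h i \<in> dist_colorings k Y // ?R" if "i \<in> {1..?d}" for i
    using that bij_betwE[OF h] Q(1) by blast
  have col_in: "col i \<in> h i" if "i \<in> {1..?d}" for i
    using in_quotient_imp_non_empty[OF equiv_coloring_equivalence hQ[OF that]]
    unfolding col_def by (simp add: some_in_eq)
  have col: "col i \<in> dist_colorings k Y" if "i \<in> {1..?d}" for i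
    using in_quotient_imp_subset[OF equiv_coloring_equivalence hQ[OF that]] col_in[OF that]
    by blast
  have col_inequiv: "i = j"
    if ij: "i \<in> {1..?d}" "j \<in> {1..?d}" and e: "equivalent_colorings Y (col i) (col j)" for i j
  proof -
    have "(col i, col j) \<in> ?R" using e col ij by (auto simp: coloring_equivalence_def)
    then have "h i = h j"
      using quotient_eqI[OF equiv_coloring_equivalence hQ hQ col_in col_in] ij by blast
    then show ?thesis using h ij by (auto simp: bij_betw_def dest: inj_onD)
  qed
  have fx: "f x \<in> {1..?d}" if "x \<in> pverts X" for x
    using f that by (auto simp: dist_colorings_def)
  define c where "c = (\<lambda>(x, y)\<in>pverts X \<times> pverts Y. col (f x) y)"
  have "distinguishing (lex_product X Y) c"
    unfolding distinguishing_def
  proof (intro allI impI, elim conjE)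
    fix \<mu> assume \<mu>: "automorphism (lex_product X Y) \<mu>"
      and pres: "\<forall>p\<in>pverts (lex_product X Y). c (\<mu> p) = c p"
    obtain \<sigma> \<phi> where \<sigma>: "automorphism X \<sigma>"
      and \<phi>: "\<And>x. x \<in> pverts X \<Longrightarrow> automorphism Y (\<phi> x)"
      and \<mu>_eq: "\<And>x y. x \<in> pverts X \<Longrightarrow> y \<in> pverts Y \<Longrightarrow> \<mu> (x, y) = (\<sigma> x, \<phi> x y)"
      using natural_automorphismE[OF X Y nat[OF \<mu>]] by metis
    have pres': "col (f (\<sigma> x)) (\<phi> x y) = col (f x) y"
      if "x \<in> pverts X" "y \<in> pverts Y" for x y
      using pres[rule_format, of "(x, y)"] that \<mu>_eq[OF that]
        automorphism_in_verts[OF \<sigma>] automorphism_in_verts[OF \<phi>]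
      by (simp add: c_def)
    have "f (\<sigma> x) = f x" if x: "x \<in> pverts X" for x
    proof -
      have "equivalent_colorings Y (col (f x)) (col (f (\<sigma> x)))"
        using \<phi>[OF x] pres'[OF x] unfolding equivalent_colorings_def by metis
      then show ?thesis
        using col_inequiv fx x automorphism_in_verts[OF \<sigma> x] by metis
    qed
    then have \<sigma>_id: "\<sigma> x = x" if "x \<in> pverts X" for x
      using f \<sigma> that unfolding dist_colorings_def distinguishing_def by blast
    have "\<phi> x y = y" if x: "x \<in> pverts X" and y: "y \<in> pverts Y" for x y
    proof -
      have "\<forall>y\<in>pverts Y. col (f x) (\<phi> x y) = col (f x) y"
        using pres'[OF x] \<sigma>_id[OF x] by simp
      then show ?thesis
        using col[OF fx[OF x]] \<phi>[OF x] y unfolding dist_colorings_def distinguishing_def by blast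
    qed
    then show "\<forall>p\<in>pverts (lex_product X Y). \<mu> p = p"
      using \<mu>_eq \<sigma>_id by auto
  qed
  moreover have "c \<in> pverts (lex_product X Y) \<rightarrow>\<^sub>E {1..k}"
  proof -
    have "col (f x) y \<in> {1..k}" if "x \<in> pverts X" "y \<in> pverts Y" for x y
      using col[OF fx[OF that(1)]] that(2) by (auto simp: dist_colorings_def)
    then show ?thesis by (auto simp: c_def PiE_iff)
  qed
  ultimately show ?thesis by (auto simp: dist_colorings_def)
qed

section \<open>The distinguishing number of a lexicographic product\<close>

theorem theorem5p1:
  fixes X :: "'a pair_pre_digraph" and Y :: "'b pair_pre_digraph"
  assumes "pair_graph X" and "pverts X \<noteq> {}"
    and "pair_graph Y" and "pverts Y \<noteq> {}"
    and "\<And>\<mu>. automorphism (lex_product X Y) \<mu> \<Longrightarrow> natural_automorphism X Y \<mu>"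
  shows "(\<exists>k>0. num_dist_colorings k Y \<ge> distinguishing_number X) \<and>
    distinguishing_number (lex_product X Y) =
      (LEAST k. k > 0 \<and> num_dist_colorings k Y \<ge> distinguishing_number X)"
proof -
  have "dist_colorings 0 (lex_product X Y) = {}"
    using assms(2,4) by (intro dist_colorings_zero) auto
  then have iff: "dist_colorings k (lex_product X Y) \<noteq> {} \<longleftrightarrow>
      k > 0 \<and> num_dist_colorings k Y \<ge> distinguishing_number X" for k
    using num_dist_colorings_ge_if_lex_product[OF assms(3,4)]
      lex_product_colorable_if_num_dist_colorings_ge[OF assms(1,4,5)]
    by (metis gr0I)
  have "dist_colorings (card (pverts (lex_product X Y))) (lex_product X Y) \<noteq> {}"
    using assms(1,3) by (intro dist_colorings_nonempty pair_graph_lex_product)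
  then show ?thesis
    using iff unfolding distinguishing_number_def[of "lex_product X Y"] by auto
qed

end
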